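(* For all integers $n \geq 1$ and $k \geq 1$, the path $P_n$ on $n$ vertices satisfies $\gamma_{all,k}^\infty(P_n)=\lceil \frac{n}{k+1} \rceil$.
   Context: Graphs are finite and simple; $d(u,v)$ denotes graph distance, and $N_k[x]=\{v: d(x,v)\le k\}$. A multiset $D$ of vertices of $G$ is a distance-$k$ dominating set if every vertex of $V(G)\setminus D$ is at distance at most $k$ from some element of $D$. Let $\mathbb{D}_{k,q}(G)$ be the set of distance-$k$ dominating multisets of cardinality $q$. For $D=\{v_1,\dots,v_q\}$ and $D'=\{u_1,\dots,u_q\}$ in $\mathbb{D}_{k,q}(G)$, $D$ transforms to $D'$ if (for some indexing) $u_i\in N_k[v_i]$ for all $i$. An eternal distance-$k$ dominating family is a subset $\mathcal{E}\subseteq\mathbb{D}_{k,q}(G)$ for some $q$ such that for every $D\in\mathcal{E}$ and every vertex $v$ there is $D'\in\mathcal{E}$ with $v\in D'$ and $D$ transforms to $D'$. The eternal distance-$k$ domination number $\gamma_{all,k}^\infty(G)$ is the minimum $q$ for which an eternal distance-$k$ dominating family of $G$ (consisting of multisets of size $q$) exists. *)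

theory Defs
  imports
    "Graph_Theory.Pair_Digraph"
    "Graph_Theory.Shortest_Path"
    "HOL-Library.Multiset"
begin

text \<open>
  The locale \<^locale>\<open>graph\<close> describes finite simple graphs, presented as symmetric
  loop-free digraphs without parallel arcs.
\<close>

context graph
begin

text \<open>All arcs have weight 1; the distance is infinite between different components.\<close>

definition gdist :: "'a \<Rightarrow> 'a \<Rightarrow> ereal" where
  "gdist u v = \<mu> (\<lambda>_. 1) u v"

definition closed_nbhd :: "nat \<Rightarrow> 'a \<Rightarrow> 'a set" where
  "closed_nbhd k x = {v \<in> verts G. gdist x v \<le> ereal (real k)}"

definition dist_dominating :: "nat \<Rightarrow> 'a multiset \<Rightarrow> bool" where
  "dist_dominating k D \<longleftrightarrow>
     set_mset D \<subseteq> verts G \<and>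
     (\<forall>v \<in> verts G - set_mset D. \<exists>x \<in># D. gdist v x \<le> ereal (real k))"

definition dist_dominating_multisets :: "nat \<Rightarrow> nat \<Rightarrow> 'a multiset set" where
  "dist_dominating_multisets k q = {D. dist_dominating k D \<and> size D = q}"

text \<open>
  \<^const>\<open>rel_mset\<close> asks for enumerations of the two multisets, with multiplicities and of the
  same length, whose entries are related position by position.
\<close>

definition transforms :: "nat \<Rightarrow> 'a multiset \<Rightarrow> 'a multiset \<Rightarrow> bool" where
  "transforms k D D' \<longleftrightarrow> rel_mset (\<lambda>v u. u \<in> closed_nbhd k v) D D'"

text \<open>
  The family has to be nonempty: the empty family satisfies the remaining conditions for
  every \<open>q\<close>, which would make the eternal domination number 0 for all graphs.
\<close>

definition eternal_dist_dom_family :: "nat \<Rightarrow> nat \<Rightarrow> 'a multiset set \<Rightarrow> bool" where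
  "eternal_dist_dom_family k q E \<longleftrightarrow>
     E \<noteq> {} \<and> E \<subseteq> dist_dominating_multisets k q \<and>
     (\<forall>D \<in> E. \<forall>v \<in> verts G. \<exists>D' \<in> E. v \<in># D' \<and> transforms k D D')"

definition eternal_dist_dom_number :: "nat \<Rightarrow> nat" where
  "eternal_dist_dom_number k = (LEAST q. \<exists>E. eternal_dist_dom_family k q E)"

lemma gdist_self_le:
  assumes "v \<in> verts G"
  shows "gdist v v \<le> 0"
  using min_cost_le_walk_cost[of v "[]" v "\<lambda>_. 1"] assms
  by (simp add: gdist_def awalk_Nil_iff zero_ereal_def)

text \<open>The minimum is attained, as the full vertex set never has to move.\<close>

lemma eternal_dist_dom_number_family:
  "\<exists>E. eternal_dist_dom_family k (eternal_dist_dom_number k) E"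
proof -
  let ?D = "mset_set (verts G)"
  have self: "v \<in> closed_nbhd k v" if "v \<in> verts G" for v
    using gdist_self_le[OF that] that
    by (auto simp: closed_nbhd_def zero_ereal_def intro: order_trans)
  have "transforms k ?D ?D"
    unfolding transforms_def
    by (rule multiset.rel_refl_strong) (simp add: self)
  then have "eternal_dist_dom_family k (card (verts G)) {?D}"
    by (simp add: eternal_dist_dom_family_def dist_dominating_multisets_def dist_dominating_def)
  then show ?thesis
    unfolding eternal_dist_dom_number_def by (rule LeastI_ex[of "\<lambda>q. \<exists>E. eternal_dist_dom_family k q E", OF exI, OF exI])
qed

end

definition path_graph :: "nat \<Rightarrow> nat pair_pre_digraph" where
  "path_graph n =
     \<lparr> pverts = {1..n},
       parcs = {(i, j). i \<in> {1..n} \<and> j \<in> {1..n} \<and> (j = i + 1 \<or> i = j + 1)} \<rparr>"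

lemma graph_path_graph: "graph (with_proj (path_graph n))"
proof -
  have "finite (parcs (path_graph n))"
    by (rule finite_subset[of _ "{1..n} \<times> {1..n}"]) (auto simp: path_graph_def)
  then have "pair_graph (path_graph n)"
    by unfold_locales (auto simp: path_graph_def symmetric_def sym_def)
  then show ?thesis
    by (rule pair_graph.pair_graphD_graph)
qed

end

theory Submission
  imports Defs
begin

text \<open>
  Upper bound: cut the path into \<open>\<lceil>n / (k + 1)\<rceil>\<close> blocks of at most \<open>k + 1\<close> consecutive vertices
  and keep exactly one guard in each; inside its block a guard reaches every vertex in one move.

  Lower bound: let \<open>f m\<close> be the minimum, over the configurations of an eternal family, of the
  number of guards in \<open>{1..m}\<close>. After an attack on \<open>m + 1\<close> there are at least \<open>f m + 1\<close> guards in
  \<open>{1..m + 1}\<close>, and all of them came from \<open>{1..m + 1 + k}\<close>. So \<open>f (m + k + 1) \<ge> f m + 1\<close> for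
  \<open>m < n\<close>, which forces \<open>\<lceil>n / (k + 1)\<rceil>\<close> guards.
\<close>

abbreviation path_digraph :: "nat \<Rightarrow> (nat, nat \<times> nat) pre_digraph" where
  "path_digraph n \<equiv> with_proj (path_graph n)"

lemma pverts_path_graph [simp]: "pverts (path_graph n) = {1..n}"
  by (simp add: path_graph_def)

lemma parcs_path_graph [simp]:
  "parcs (path_graph n) = {(i, j). i \<in> {1..n} \<and> j \<in> {1..n} \<and> (j = i + 1 \<or> i = j + 1)}"
  by (simp add: path_graph_def)

lemma (in wf_digraph) awalk_cost_one: "awalk_cost (\<lambda>_. 1) p = real (length p)"
  by (induction p) auto

text \<open>Each arc changes the vertex number by exactly 1; the triangle inequality does the
  rest.\<close>

lemma path_awalk_length_ge:
  assumes "pre_digraph.awalk (path_digraph n) u p v"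
  shows "\<bar>int u - int v\<bar> \<le> int (length p)"
proof -
  interpret graph "path_digraph n" by (rule graph_path_graph)
  show ?thesis
    using assms
  proof (induction p arbitrary: u)
    case Nil
    then show ?case by (simp add: awalk_Nil_iff)
  next
    case (Cons e p)
    obtain i j where e: "e = (i, j)" by fastforce
    have "u = i" "j = i + 1 \<or> i = j + 1" "awalk j p v"
      using Cons.prems unfolding e by (auto simp: awalk_Cons_iff)
    with Cons.IH[of j] show ?case by auto
  qed
qed

lemma path_awalk_exists:
  assumes "u \<in> {1..n}" "v \<in> {1..n}"
  shows "\<exists>p. pre_digraph.awalk (path_digraph n) u p v \<and> int (length p) = \<bar>int u - int v\<bar>"
proof -
  interpret graph "path_digraph n" by (rule graph_path_graph)
  show ?thesis
    using assms
  proof (induction "nat \<bar>int u - int v\<bar>" arbitrary: u)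
    case 0
    then have "awalk u [] v" "u = v" by (auto simp: awalk_Nil_iff)
    then show ?case by force
  next
    case (Suc d)
    \<comment> \<open>The neighbour of \<open>u\<close> one step closer to \<open>v\<close>; it
      stays in \<open>{1..n}\<close> because it lies between \<open>u\<close> and
      \<open>v\<close>.\<close>
    define w where "w = (if u < v then u + 1 else u - 1)"
    have w: "w \<in> {1..n}" "d = nat \<bar>int w - int v\<bar>" "(u, w) \<in> arcs (path_digraph n)"
      using Suc.hyps(2) Suc.prems by (auto simp: w_def)
    obtain p where p: "awalk w p v" "int (length p) = \<bar>int w - int v\<bar>"
      using Suc.hyps(1)[OF w(2) w(1) Suc.prems(2)] by blast
    have "awalk u ((u, w) # p) v"
      using p(1) w(3) by (simp add: awalk_Cons_iff)
    moreover have "int (length ((u, w) # p)) = \<bar>int u - int v\<bar>"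
      using p(2) w(2) Suc.hyps(2) by simp
    ultimately show ?case by blast
  qed
qed

lemma path_gdist:
  assumes "u \<in> {1..n}" "v \<in> {1..n}"
  shows "graph.gdist (path_digraph n) u v = ereal (real_of_int \<bar>int u - int v\<bar>)"
proof -
  interpret graph "path_digraph n" by (rule graph_path_graph)
  obtain p where "awalk u p v" "int (length p) = \<bar>int u - int v\<bar>"
    using path_awalk_exists[OF assms] by blast
  then have "gdist u v \<le> ereal (real_of_int \<bar>int u - int v\<bar>)"
    using min_cost_le_walk_cost[of u p v "\<lambda>_. 1"]
    by (metis awalk_cost_one gdist_def of_int_of_nat_eq)
  moreover have "ereal (real_of_int \<bar>int u - int v\<bar>) \<le> gdist u v"
    unfolding gdist_def \<mu>_def
  proof (rule INF_greatest)
    fix p assume "p \<in> {p. awalk u p v}"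
    then have "\<bar>int u - int v\<bar> \<le> int (length p)"
      using path_awalk_length_ge by blast
    then have "real_of_int \<bar>int u - int v\<bar> \<le> real (length p)"
      by linarith
    then show "ereal (real_of_int \<bar>int u - int v\<bar>) \<le> ereal (awalk_cost (\<lambda>_. 1) p)"
      by (simp add: awalk_cost_one)
  qed
  ultimately show ?thesis by (rule antisym)
qed

lemma path_gdist_le_iff:
  assumes "u \<in> {1..n}" "v \<in> {1..n}"
  shows "graph.gdist (path_digraph n) u v \<le> ereal (real k) \<longleftrightarrow> \<bar>int u - int v\<bar> \<le> int k"
  using path_gdist[OF assms] by (simp, linarith)

text \<open>The matching pairs each element of \<open>B\<close> satisfying \<open>Q\<close> with its
  own element of \<open>A\<close>, which satisfies \<open>P\<close>. It bounds the guards that end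
  in a region by those that started in a larger one.\<close>

lemma size_filter_rel_mset_le:
  assumes "rel_mset R A B" and "\<And>a b. R a b \<Longrightarrow> Q b \<Longrightarrow> P a"
  shows "size (filter_mset Q B) \<le> size (filter_mset P A)"
proof -
  obtain xs ys where "mset xs = A" "mset ys = B" "list_all2 R xs ys"
    using assms(1) by (auto simp: rel_mset_def)
  moreover from \<open>list_all2 R xs ys\<close> have "length (filter Q ys) \<le> length (filter P xs)"
    by induction (use assms(2) in auto)
  ultimately show ?thesis
    by (metis mset_filter size_mset)
qed

lemma path_eternal_family_lower_bound:
  assumes "graph.eternal_dist_dom_family (path_digraph n) k q E"
  shows "n \<le> q * (k + 1)"
proof -
  interpret graph "path_digraph n" by (rule graph_path_graph)
  \<comment> \<open>For \<open>j > 0\<close> the side condition says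
    \<open>(j - 1) * (k + 1) < n\<close>: the vertex attacked in the induction step exists, while
    the threshold \<open>j * (k + 1)\<close> itself may exceed \<open>n\<close>.\<close>
  have guards: "j \<le> size {#x \<in># D. x \<le> j * (k + 1)#}"
    if "D \<in> E" "j * (k + 1) < n + (k + 1)" for j D
    using that
  proof (induction j arbitrary: D)
    case 0
    show ?case by simp
  next
    case (Suc j)
    define m where "m = j * (k + 1)"
    have "m + 1 \<in> verts (path_digraph n)"
      using Suc.prems(2) by (simp add: m_def)
    then obtain D' where D': "D' \<in> E" "m + 1 \<in># D'" "transforms k D D'"
      using assms Suc.prems(1) unfolding eternal_dist_dom_family_def by blast
    have D_verts: "set_mset D \<subseteq> {1..n}"
      using assms Suc.prems(1)
      by (auto simp: eternal_dist_dom_family_def dist_dominating_multisets_def dist_dominating_def)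
    have rel: "rel_mset (\<lambda>v u. \<bar>int v - int u\<bar> \<le> int k) D D'"
      using D'(3)[unfolded transforms_def]
      by (rule multiset.rel_mono_strong) (use D_verts in \<open>auto simp: closed_nbhd_def path_gdist_le_iff\<close>)
    have "j \<le> size {#x \<in># D'. x \<le> m#}"
      using Suc.IH[OF D'(1)] Suc.prems(2) by (simp add: m_def)
    \<comment> \<open>The guard answering the attack on \<open>m + 1\<close> is counted only on the
      right.\<close>
    also have "\<dots> < size {#x \<in># D'. x \<le> m + 1#}"
    proof (rule mset_subset_size)
      have "{#x \<in># D'. x \<le> m#} \<subseteq># {#x \<in># D'. x \<le> m + 1#}"
        by (simp add: subseteq_mset_def)
      moreover have "m + 1 \<in># {#x \<in># D'. x \<le> m + 1#}" "m + 1 \<notin># {#x \<in># D'. x \<le> m#}"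
        using D'(2) by auto
      ultimately show "{#x \<in># D'. x \<le> m#} \<subset># {#x \<in># D'. x \<le> m + 1#}"
        by (metis subset_mset.less_le)
    qed
    \<comment> \<open>Guards move at most \<open>k\<close>, so those now at most
      \<open>m + 1\<close> came from at most \<open>m + 1 + k = Suc j * (k + 1)\<close>.\<close>
    also have "\<dots> \<le> size {#x \<in># D. x \<le> m + 1 + k#}"
      by (rule size_filter_rel_mset_le[OF rel]) auto
    finally show ?case
      by (simp add: m_def algebra_simps)
  qed
  obtain D where D: "D \<in> E" "size D = q"
    using assms by (auto simp: eternal_dist_dom_family_def dist_dominating_multisets_def)
  show ?thesis
  proof (rule ccontr)
    assume "\<not> n \<le> q * (k + 1)"
    \<comment> \<open>For \<open>j = Suc q\<close> the side condition of \<open>guards\<close> is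
      exactly \<open>q * (k + 1) < n\<close>.\<close>
    then have "Suc q \<le> size {#x \<in># D. x \<le> Suc q * (k + 1)#}"
      using guards[OF D(1), of "Suc q"] by simp
    then show False
      using D(2) size_filter_mset_lesseq[of "\<lambda>x. x \<le> Suc q * (k + 1)" D] by simp
  qed
qed

text \<open>With equal quotients the difference is one of remainders, which lie between 0 and
  \<open>k\<close>.\<close>

lemma abs_diff_le_if_div_eq:
  fixes u v k :: nat
  assumes "(u - 1) div (k + 1) = (v - 1) div (k + 1)" "u \<ge> 1" "v \<ge> 1"
  shows "\<bar>int u - int v\<bar> \<le> int k"
proof -
  define a b where "a = u - 1" and "b = v - 1"
  have "a = (a div (k + 1)) * (k + 1) + a mod (k + 1)" "b = (a div (k + 1)) * (k + 1) + b mod (k + 1)"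
    using assms(1) by (metis a_def b_def div_mult_mod_eq)+
  moreover have "a mod (k + 1) \<le> k" "b mod (k + 1) \<le> k"
    by (simp_all add: less_Suc_eq_le[symmetric])
  ultimately have "a \<le> b + k" "b \<le> a + k"
    by linarith+
  then show ?thesis
    using assms(2,3) by (simp add: a_def b_def)
qed

text \<open>The first hypothesis puts every vertex into one of the blocks
  \<open>0, ..., q - 1\<close>; the second makes each of these blocks nonempty.\<close>

lemma path_eternal_family_exists:
  assumes "n \<le> q * (k + 1)" "q * (k + 1) < n + (k + 1)"
  shows "\<exists>E. graph.eternal_dist_dom_family (path_digraph n) k q E"
proof -
  interpret graph "path_digraph n" by (rule graph_path_graph)
  define block where "block v = (v - 1) div (k + 1)" for v :: nat
  \<comment> \<open>\<open>f i\<close> is the position of the guard of block \<open>i\<close>;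
    values at \<open>i \<ge> q\<close> are arbitrary and ignored by \<open>conf\<close>.\<close>
  define F where "F = {f. \<forall>i<q. f i \<in> {1..n} \<and> block (f i) = i}"
  define conf where "conf f = image_mset f (mset_set {..<q})" for f :: "nat \<Rightarrow> nat"
  have set_conf: "set_mset (conf f) = f ` {..<q}" for f
    by (simp add: conf_def)
  have close: "\<bar>int u - int v\<bar> \<le> int k" if "block u = block v" "u \<in> {1..n}" "v \<in> {1..n}" for u v
    using that by (intro abs_diff_le_if_div_eq) (auto simp: block_def)
  have block_less: "block v < q" if "v \<in> {1..n}" for v
  proof -
    have "v - 1 < q * (k + 1)" using that assms(1) by auto
    then show ?thesis unfolding block_def by (rule less_mult_imp_div_less)
  qed
  \<comment> \<open>Each guard on the first vertex of its block, which exists even if the last block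
    is cut short.\<close>
  have "(\<lambda>i. i * (k + 1) + 1) \<in> F"
  proof -
    have "i * (k + 1) + 1 \<le> n" if "i < q" for i
    proof -
      have "(i + 1) * (k + 1) \<le> q * (k + 1)"
        using that by (intro mult_right_mono) auto
      with assms(2) show ?thesis by (simp add: algebra_simps)
    qed
    then show ?thesis by (auto simp: F_def block_def simp del: mult_Suc_right)
  qed
  then have "conf ` F \<noteq> {}" by blast
  moreover have "conf f \<in> dist_dominating_multisets k q" if "f \<in> F" for f
  proof -
    have "\<exists>x \<in># conf f. gdist v x \<le> ereal (real k)" if v: "v \<in> {1..n}" for v
    proof
      show "f (block v) \<in># conf f"
        using block_less[OF v] by (simp add: set_conf)
      have "f (block v) \<in> {1..n}" "block (f (block v)) = block v"
        using \<open>f \<in> F\<close> block_less[OF v] by (auto simp: F_def)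
      then show "gdist v (f (block v)) \<le> ereal (real k)"
        using v close[of v "f (block v)"] by (simp add: path_gdist_le_iff)
    qed
    moreover have "set_mset (conf f) \<subseteq> {1..n}"
      using that by (auto simp: set_conf F_def)
    ultimately show ?thesis
      by (auto simp: dist_dominating_multisets_def dist_dominating_def conf_def)
  qed
  moreover have "\<exists>D' \<in> conf ` F. v \<in># D' \<and> transforms k (conf f) D'"
    if f: "f \<in> F" and v: "v \<in> {1..n}" for f v
  proof -
    \<comment> \<open>Only the guard of the attacked block moves.\<close>
    define g where "g = f(block v := v)"
    have "g \<in> F" using f v by (auto simp: F_def g_def)
    moreover have "v \<in># conf g"
      using block_less[OF v] by (auto simp: set_conf g_def)
    \<comment> \<open>Guards are matched by block index, so the relation need only hold between
      \<open>f i\<close> and \<open>g i\<close>.\<close>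
    moreover have "transforms k (conf f) (conf g)"
      unfolding transforms_def conf_def multiset.rel_map
    proof (rule multiset.rel_refl_strong)
      fix i assume "i \<in># mset_set {..<q}"
      then have "f i \<in> {1..n}" "g i \<in> {1..n}" "block (f i) = block (g i)"
        using f \<open>g \<in> F\<close> by (auto simp: F_def)
      then show "g i \<in> closed_nbhd k (f i)"
        using close[of "f i" "g i"] by (simp add: closed_nbhd_def path_gdist_le_iff)
    qed
    ultimately show ?thesis by blast
  qed
  ultimately have "eternal_dist_dom_family k q (conf ` F)"
    by (auto simp: eternal_dist_dom_family_def)
  then show ?thesis ..
qed

theorem theorem2:
  fixes n k :: nat
  assumes "n \<ge> 1" and "k \<ge> 1"
  shows "int (graph.eternal_dist_dom_number (with_proj (path_graph n)) k)
           = \<lceil>real n / (real k + 1)\<rceil>"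
proof -
  interpret graph "path_digraph n" by (rule graph_path_graph)
  define q where "q = nat \<lceil>real n / (real k + 1)\<rceil>"
  \<comment> \<open>The quotient exceeds -1, so its ceiling is nonnegative and \<open>nat\<close>
    truncates nothing.\<close>
  have q: "int q = \<lceil>real n / (real k + 1)\<rceil>"
    by (simp add: q_def less_le_trans[of "-1" 0])
  then have "real n / (real k + 1) \<le> real q" "real q < real n / (real k + 1) + 1"
    by linarith+
  then have "real n \<le> real q * (real k + 1)" "real q * (real k + 1) < real n + (real k + 1)"
    by (simp_all add: field_simps)
  then have "real n \<le> real (q * (k + 1))" "real (q * (k + 1)) < real (n + (k + 1))"
    by (simp_all add: algebra_simps)
  then have q_bounds: "n \<le> q * (k + 1)" "q * (k + 1) < n + (k + 1)"
    by (simp_all only: of_nat_le_iff of_nat_less_iff)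
  have "eternal_dist_dom_number k = q"
    unfolding eternal_dist_dom_number_def
  proof (rule Least_equality)
    show "\<exists>E. eternal_dist_dom_family k q E"
      using q_bounds by (rule path_eternal_family_exists)
  next
    fix r assume "\<exists>E. eternal_dist_dom_family k r E"
    then have "n \<le> r * (k + 1)"
      using path_eternal_family_lower_bound by blast
    \<comment> \<open>Cancelling \<open>k + 1\<close> leaves \<open>q < r + 1\<close>.\<close>
    then have "q * (k + 1) < (r + 1) * (k + 1)"
      using q_bounds(2) by simp
    then show "q \<le> r"
      by (simp only: mult_less_cancel2) simp
  qed
  then show ?thesis using q by simp
qed

end
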